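(* Consider a single-phase chain feeder with nodes $0,1,\dots,N$, in which line $n$ ($1\le n\le N$) connects nodes $n-1$ and $n$ and has impedance $z_n\in\mathbb{C}$, and let the phase reference be chosen with respect to the first node, i.e. $\delta_0=0$. Let $j_n=|j_n|e^{i\phi_n}$ be the local current of line $n$, related to the global line current $j^g_n$ by $j^g_n=j_ne^{i\delta_{n-1}}$. Set $\Delta_n=\delta_{n-1}-\delta_n$. Then $$v_{n-1}-v_ne^{-i\Delta_n}=j_nz_n\quad(1\le n\le N),\qquad j_{n+1}=j_ne^{i\Delta_n}-i_n\quad(1\le n\le N-1).$$
   Context: The network is in steady state and all quantities are phasors; $i$ in an exponent is the imaginary unit. At node $n$: $v_n=|v_n|\ge 0$ is the local voltage; $\delta_n\in\mathbb{R}$ is the phase of the voltage phasor with respect to the global phase reference; $v^g_n=v_ne^{i\delta_n}$ is the global voltage; $i_n=|i_n|e^{i\theta_n}\in\mathbb{C}$ is the local current consumed (or injected) at node $n$, where $\theta_n$ is the angle between the voltage and current phasors; $i^g_n=i_ne^{i\delta_n}$ is the global node current. The global current in line $n$, flowing from node $n-1$ to node $n$, is $j^g_n\in\mathbb{C}$. The feeder obeys Ohm's law $v^g_{n-1}-v^g_n=j^g_nz_n$ for $1\le n\le N$, and Kirchhoff's current law $j^g_{n+1}=j^g_n-i^g_n$ for $1\le n\le N-1$. *)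

theory Defs
  imports Complex_Main
begin

end

theory Submission
  imports Defs
begin

text \<open>
  Both laws are linear in the phasors, so each survives a rotation of the reference frame.
  Every global phasor is a local one times the rotation \<open>exp (\<i> \<delta>)\<close> of the node it is referred
  to, and neighbouring rotations differ by the factor \<open>exp (\<i> \<Delta>)\<close>. Ohm's law for line \<open>n\<close>
  is brought to the frame of node \<open>n - 1\<close>, Kirchhoff's law at node \<open>n\<close> to the frame of node
  \<open>n\<close>; the common rotation is then cancelled, an exponential being nonzero.
\<close>

theorem proposition2:
  fixes N :: nat
    and v \<delta> \<theta> \<phi> \<Delta> :: "nat \<Rightarrow> real"
    and i j z vg ig jg :: "nat \<Rightarrow> complex"
  assumes v_nonneg: "\<forall>n\<in>{0..N}. v n \<ge> 0"
    and i_polar: "\<forall>n\<in>{0..N}. i n = complex_of_real (cmod (i n)) * exp (\<i> * complex_of_real (\<theta> n))"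
    and global_voltage: "\<forall>n\<in>{0..N}. vg n = complex_of_real (v n) * exp (\<i> * complex_of_real (\<delta> n))"
    and global_node_current: "\<forall>n\<in>{0..N}. ig n = i n * exp (\<i> * complex_of_real (\<delta> n))"
    and ohm: "\<forall>n\<in>{1..N}. vg (n - 1) - vg n = jg n * z n"
    and kirchhoff: "\<forall>n. 1 \<le> n \<and> n < N \<longrightarrow> jg (n + 1) = jg n - ig n"
    and phase_reference: "\<delta> 0 = 0"
    and j_polar: "\<forall>n\<in>{1..N}. j n = complex_of_real (cmod (j n)) * exp (\<i> * complex_of_real (\<phi> n))"
    and local_line_current: "\<forall>n\<in>{1..N}. jg n = j n * exp (\<i> * complex_of_real (\<delta> (n - 1)))"
    and phase_difference: "\<forall>n\<in>{1..N}. \<Delta> n = \<delta> (n - 1) - \<delta> n"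
  shows "(\<forall>n\<in>{1..N}. complex_of_real (v (n - 1))
              - complex_of_real (v n) * exp (- \<i> * complex_of_real (\<Delta> n)) = j n * z n)
       \<and> (\<forall>n. 1 \<le> n \<and> n < N \<longrightarrow> j (n + 1) = j n * exp (\<i> * complex_of_real (\<Delta> n)) - i n)"
proof (intro conjI ballI allI impI)
  fix n assume n: "n \<in> {1..N}"
  let ?r = "exp (\<i> * complex_of_real (\<delta> (n - 1)))"
  have shift: "exp (\<i> * complex_of_real (\<delta> n)) = ?r * exp (- \<i> * complex_of_real (\<Delta> n))"
    unfolding bspec [OF phase_difference n] exp_add [symmetric] by (simp add: algebra_simps)
  have nodes: "n - 1 \<in> {0..N}" "n \<in> {0..N}" using n by auto
  have "?r * (complex_of_real (v (n - 1)) - complex_of_real (v n) * exp (- \<i> * complex_of_real (\<Delta> n)))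
      = vg (n - 1) - vg n"
    unfolding bspec [OF global_voltage nodes(1)] bspec [OF global_voltage nodes(2)] shift
    by (simp only: algebra_simps)
  also have "\<dots> = ?r * (j n * z n)"
    unfolding bspec [OF ohm n] bspec [OF local_line_current n] by (simp only: ac_simps)
  finally show "complex_of_real (v (n - 1))
      - complex_of_real (v n) * exp (- \<i> * complex_of_real (\<Delta> n)) = j n * z n"
    by (simp only: mult_cancel_left exp_not_eq_zero simp_thms)
next
  fix n assume n: "1 \<le> n \<and> n < N"
  let ?r = "exp (\<i> * complex_of_real (\<delta> n))"
  have lines: "n \<in> {1..N}" "n + 1 \<in> {1..N}" and node: "n \<in> {0..N}" using n by auto
  have shift: "exp (\<i> * complex_of_real (\<delta> (n - 1))) = ?r * exp (\<i> * complex_of_real (\<Delta> n))"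
    unfolding bspec [OF phase_difference lines(1)] exp_add [symmetric] by (simp add: algebra_simps)
  \<comment> \<open>The current of line \<open>n + 1\<close> is referred to its sending node, so the
    common frame of both lines is that of node \<open>n\<close>.\<close>
  have "?r * j (n + 1) = jg (n + 1)"
    using bspec [OF local_line_current lines(2)] by simp
  also have "\<dots> = jg n - ig n" using kirchhoff n by blast
  also have "\<dots> = ?r * (j n * exp (\<i> * complex_of_real (\<Delta> n)) - i n)"
    unfolding bspec [OF local_line_current lines(1)] bspec [OF global_node_current node] shift
    by (simp only: algebra_simps)
  finally show "j (n + 1) = j n * exp (\<i> * complex_of_real (\<Delta> n)) - i n"
    by (simp only: mult_cancel_left exp_not_eq_zero simp_thms)
qed

end
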